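(* Let $T\approx1.83929$ be the real root of $x^3=x^2+x+1$. For any $q\in[T,2)$ there exists $x\in[0,1/(q-1)]$ which has exactly two expansions in base $q$.
   Context: An expansion of $x\ge0$ in base $q\in(1,2)$ is a 0-1 sequence $(a_n)_{n\ge1}$ with $x=\sum_{n\ge1}a_nq^{-n}$. *)

theory Defs
  imports Complex_Main
begin

text \<open>The digit written \<open>a\<^sub>n\<close> with \<open>n \<ge> 1\<close> on paper is \<open>a (n - 1)\<close> here, so that a sequence of digits
  is a function on all of \<open>nat\<close> and carries no irrelevant value at index 0. Hence distinct
  functions are distinct expansions, and expansions can be counted with \<open>card\<close>.\<close>

definition is_expansion :: "real \<Rightarrow> real \<Rightarrow> (nat \<Rightarrow> nat) \<Rightarrow> bool" where
  "is_expansion q x a \<longleftrightarrow>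
     range a \<subseteq> {0, 1} \<and> (\<lambda>n. real (a n) / q ^ Suc n) sums x"

definition tribonacci :: real where
  "tribonacci = (THE x. x ^ 3 = x ^ 2 + x + 1)"

lemma tribonacci_root_unique: "\<exists>!x::real. x ^ 3 = x ^ 2 + x + 1"
proof -
  define f :: "real \<Rightarrow> real" where "f x = x ^ 3 - x ^ 2 - x - 1" for x
  have "\<exists>x\<ge>1. x \<le> 2 \<and> f x = 0"
    by (rule IVT) (auto simp: f_def intro!: continuous_intros)
  then obtain x where x: "x \<ge> 1" "f x = 0" by blast
  have "y = x" if "f y = 0" for y
  proof (rule ccontr)
    assume "y \<noteq> x"
    have "(y - x) * (y ^ 2 + x * y + x ^ 2 - y - x - 1) = f y - f x"
      unfolding f_def by algebra
    with that x \<open>y \<noteq> x\<close> have 1: "y ^ 2 + x * y + x ^ 2 - y - x - 1 = 0" by simp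
    have x3: "x ^ 3 = x ^ 2 + x + 1" using x by (simp add: f_def)
    have gt: "x > 5/3"
    proof (rule ccontr)
      assume "\<not> x > 5/3"
      then have "x ^ 2 * (x - 1) \<le> (5/3) ^ 2 * (2/3)"
        using x(1) by (intro mult_mono power_mono) auto
      moreover have "x ^ 2 * (x - 1) = x + 1" using x3 by algebra
      ultimately show False using x(1) by (simp add: power2_eq_square)
    qed
    have "(2 * y + x - 1) ^ 2 + (3 * x - 5) * (x + 1) = 4 * (y ^ 2 + x * y + x ^ 2 - y - x - 1)"
      by (simp add: power2_eq_square algebra_simps)
    then have "(2 * y + x - 1) ^ 2 + (3 * x - 5) * (x + 1) = 0"
      unfolding 1 by simp
    moreover have "(3 * x - 5) * (x + 1) > 0"
      by (rule mult_pos_pos) (use gt in linarith)+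
    ultimately show False
      using zero_le_power2[of "2 * y + x - 1"] by linarith
  qed
  moreover have "f y = 0 \<longleftrightarrow> y ^ 3 = y ^ 2 + y + 1" for y
    unfolding f_def by linarith
  ultimately show ?thesis using x(2) by blast
qed

lemma tribonacci_root: "tribonacci ^ 3 = tribonacci ^ 2 + tribonacci + 1"
  unfolding tribonacci_def by (rule theI'[OF tribonacci_root_unique])

end

theory Submission
  imports Defs
begin

text \<open>If \<open>u\<close> and \<open>u + 1\<close> both have a unique expansion, then \<open>(u + 1) / q\<close> has exactly two: the first
  digit is free and determines the rest. For \<open>q > T\<close> every sequence that contains neither \<open>000\<close> nor
  \<open>111\<close> is a unique expansion, and it stays one after prefixing any number of equal digits.
  The values of such sequences, with a prescribed memory of the last run of equal digits,
  form Cantor sets. These are thick enough (for \<open>q \<le> 2\<close>) that the sum of two of them is an interval;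
  as complementing digits reflects these sets, differences are covered too. Prefixing \<open>1\<close> to one
  sequence and \<open>0\<close> to the other turns a difference \<open>d\<close> of values into \<open>(1 + d) / q\<close>, so
  difference 1 is reached after iterating \<open>d \<mapsto> q d - 1\<close> from 1 until it falls into the interval of
  differences. For \<open>q = T\<close> this iteration arrives at 0, and any unique expansion
  may be taken for both sequences.\<close>

text \<open>Iterating the step gives \<open>f n \<le> K / q ^ k\<close> for all \<open>k\<close>.
  This serves for errors that grow by the factor \<open>q\<close> per digit and yet stay
  bounded.\<close>

lemma nonpos_by_scaling:
  fixes f :: "nat \<Rightarrow> real"
  assumes q: "1 < q" and step: "\<And>n. f n \<le> f (Suc n) / q" and bound: "\<And>n. f n \<le> K"
  shows "f n \<le> 0"
proof -
  have "f n \<le> K * inverse q ^ k" for k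
  proof (induction k arbitrary: n)
    case (Suc k)
    have "f n \<le> f (Suc n) / q" by (rule step)
    also have "\<dots> \<le> (K * inverse q ^ k) / q"
      using Suc q by (intro divide_right_mono) auto
    finally show ?case by (simp add: field_simps)
  qed (simp add: bound)
  moreover have "(\<lambda>k. K * inverse q ^ k) \<longlonglongrightarrow> K * 0"
    using q by (intro tendsto_intros LIMSEQ_power_zero) (auto simp: field_simps)
  ultimately show ?thesis by (intro LIMSEQ_le_const[of _ 0]) auto
qed

section \<open>Values of 0-1 sequences in base \<open>q\<close>\<close>

locale expansion_base =
  fixes q :: real
  assumes q_gt_1: "1 < q" and q_less_2: "q < 2"
begin

text \<open>The value of the all-ones sequence, hence the largest value.\<close>

definition L :: real where "L = 1 / (q - 1)"

definition digits :: "(nat \<Rightarrow> nat) \<Rightarrow> bool" where "digits a \<longleftrightarrow> range a \<subseteq> {0, 1}"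

definition val :: "(nat \<Rightarrow> nat) \<Rightarrow> real" where "val a = (\<Sum>n. real (a n) / q ^ Suc n)"

lemma q_mult_L: "q * L = L + 1"
  using q_gt_1 by (simp add: L_def field_simps)

lemma L_gt_1: "1 < L"
  using q_gt_1 q_less_2 by (simp add: L_def)

lemma digits_cases: "digits a \<Longrightarrow> a n = 0 \<or> a n = 1"
  by (auto simp: digits_def)

lemma digits_shift: "digits a \<Longrightarrow> digits (\<lambda>k. a (n + k))"
  by (simp add: digits_def image_subset_iff)

lemma digits_case_nat: "digits (case_nat d a) \<longleftrightarrow> d \<in> {0, 1} \<and> digits a"
  by (auto simp: digits_def image_subset_iff split: nat.splits)

lemma geometric_sums_L: "(\<lambda>n. 1 / q ^ Suc n) sums L"
proof -
  have "(\<lambda>n. (1 / q) * (1 / q) ^ n) sums ((1 / q) * (1 / (1 - 1 / q)))"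
    using q_gt_1 by (intro sums_mult geometric_sums) auto
  moreover have "(1 / q) * (1 / (1 - 1 / q)) = L"
    using q_gt_1 by (simp add: L_def field_simps)
  ultimately show ?thesis by (simp add: power_one_over field_simps)
qed

lemma digit_term_le: "digits a \<Longrightarrow> real (a n) / q ^ Suc n \<le> 1 / q ^ Suc n"
  using q_gt_1 digits_cases[of a n] by (auto simp: divide_right_mono)

lemma summable_digits:
  assumes "digits a"
  shows "summable (\<lambda>n. real (a n) / q ^ Suc n)"
proof (rule summable_comparison_test')
  show "summable (\<lambda>n. 1 / q ^ Suc n)"
    using geometric_sums_L by (rule sums_summable)
  show "norm (real (a n) / q ^ Suc n) \<le> 1 / q ^ Suc n" if "0 \<le> n" for n
    using digit_term_le[OF assms, of n] q_gt_1 by simp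
qed

lemma is_expansion_iff: "is_expansion q x a \<longleftrightarrow> digits a \<and> val a = x"
  using summable_digits by (auto simp: is_expansion_def digits_def val_def sums_iff)

lemma val_nonneg: "digits a \<Longrightarrow> 0 \<le> val a"
  unfolding val_def using q_gt_1 by (intro suminf_nonneg summable_digits) auto

lemma val_le_L: "digits a \<Longrightarrow> val a \<le> L"
  unfolding val_def sums_unique[OF geometric_sums_L]
  by (intro suminf_le digit_term_le summable_digits sums_summable[OF geometric_sums_L])

lemma val_complement:
  assumes "digits a" "\<And>n. b n = 1 - a n"
  shows "val b = L - val a"
proof -
  have "(\<lambda>n. 1 / q ^ Suc n - real (a n) / q ^ Suc n) sums (L - val a)"
    unfolding val_def
    by (intro sums_diff geometric_sums_L summable_sums summable_digits assms)
  moreover have "1 / q ^ Suc n - real (a n) / q ^ Suc n = real (b n) / q ^ Suc n" for n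
    using digits_cases[OF assms(1), of n] assms(2) by auto
  ultimately show ?thesis by (simp add: val_def sums_iff)
qed

lemma val_unfold:
  assumes "digits a"
  shows "val a = (real (a 0) + val (\<lambda>k. a (Suc k))) / q"
proof -
  have "val a = real (a 0) / q + (\<Sum>n. real (a (Suc n)) / q ^ Suc (Suc n))"
    unfolding val_def using suminf_split_head[OF summable_digits[OF assms]] by simp
  also have "(\<Sum>n. real (a (Suc n)) / q ^ Suc (Suc n))
      = (\<Sum>n. real (a (Suc n)) / q ^ Suc n / q)"
    by (simp add: field_simps)
  also have "\<dots> = val (\<lambda>k. a (Suc k)) / q"
    unfolding val_def using summable_digits[OF digits_shift[OF assms, of 1]]
    by (subst suminf_divide) auto
  finally show ?thesis by (simp add: add_divide_distrib)
qed

lemma val_shift_unfold: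
  assumes "digits a"
  shows "val (\<lambda>k. a (n + k)) = (real (a n) + val (\<lambda>k. a (Suc n + k))) / q"
  using val_unfold[OF digits_shift[OF assms, of n]] by simp

lemma val_case_nat: "digits (case_nat d a) \<Longrightarrow> val (case_nat d a) = (real d + val a) / q"
  using val_unfold[of "case_nat d a"] by simp

section \<open>Unique expansions and differences of their values\<close>

text \<open>A sufficient condition for \<open>a\<close> to be the only expansion of its value: no digit of \<open>a\<close> can be
  altered, as the remainder would exceed \<open>L\<close> or drop below 0.\<close>

definition univoque :: "(nat \<Rightarrow> nat) \<Rightarrow> bool" where
  "univoque a \<longleftrightarrow> digits a \<and>
     (\<forall>n. (a n = 0 \<longrightarrow> val (\<lambda>k. a (Suc n + k)) < 1) \<and>
          (a n = 1 \<longrightarrow> L - val (\<lambda>k. a (Suc n + k)) < 1))"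

text \<open>At a first disagreement the tails would differ by exactly 1, pushing the tail of
  \<open>a\<close> up to at least 1 or the tail of \<open>b\<close> above \<open>L\<close>. So
  digits agree, and equality passes on to the next tails.\<close>

lemma univoque_unique:
  assumes a: "univoque a" and b: "digits b" and eq: "val b = val a"
  shows "b = a"
proof -
  have da: "digits a" using a by (simp add: univoque_def)
  have same_digit: "b n = a n"
    if "val (\<lambda>k. b (n + k)) = val (\<lambda>k. a (n + k))" for n
  proof (rule ccontr)
    assume "b n \<noteq> a n"
    have "real (b n) + val (\<lambda>k. b (Suc n + k)) = real (a n) + val (\<lambda>k. a (Suc n + k))"
      using that val_shift_unfold[OF da, of n] val_shift_unfold[OF b, of n] q_gt_1 by simp
    moreover have "0 \<le> val (\<lambda>k. b (Suc n + k))" "val (\<lambda>k. b (Suc n + k)) \<le> L"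
      using val_nonneg val_le_L digits_shift[OF b, of "Suc n"] by auto
    moreover have "a n = 0 \<longrightarrow> val (\<lambda>k. a (Suc n + k)) < 1"
        "a n = 1 \<longrightarrow> L - val (\<lambda>k. a (Suc n + k)) < 1"
      using a unfolding univoque_def by blast+
    ultimately show False
      using digits_cases[OF da, of n] digits_cases[OF b, of n] \<open>b n \<noteq> a n\<close> by auto
  qed
  have "val (\<lambda>k. b (n + k)) = val (\<lambda>k. a (n + k))" for n
  proof (induction n)
    case (Suc n)
    then show ?case
      using same_digit[OF Suc] val_shift_unfold[OF da, of n] val_shift_unfold[OF b, of n] q_gt_1
      by simp
  qed (simp add: eq)
  then show ?thesis using same_digit by blast
qed

lemma univoque_case_nat:
  assumes "univoque a" "d \<in> {0, 1}" "d = 0 \<Longrightarrow> val a < 1" "d = 1 \<Longrightarrow> L - val a < 1"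
  shows "univoque (case_nat d a)"
  unfolding univoque_def
proof (intro conjI allI)
  show "digits (case_nat d a)"
    using assms by (simp add: digits_case_nat univoque_def)
  fix n
  show "case_nat d a n = 0 \<longrightarrow> val (\<lambda>k. case_nat d a (Suc n + k)) < 1"
    "case_nat d a n = 1 \<longrightarrow> L - val (\<lambda>k. case_nat d a (Suc n + k)) < 1"
    using assms by (cases n; auto simp: univoque_def)+
qed

lemma two_expansions:
  assumes a: "univoque a" and b: "univoque b" and diff: "val a - val b = 1"
  shows "\<exists>x \<in> {0..1 / (q - 1)}. card {a. is_expansion q x a} = 2"
proof
  have da: "digits a" and db: "digits b" using a b by (simp_all add: univoque_def)
  \<comment> \<open>For this point, first digit 0 leaves \<open>val a\<close> for the tail, and
    first digit 1 leaves \<open>val a - 1 = val b\<close>.\<close>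
  have "{c. is_expansion q (val a / q) c} = {case_nat 0 a, case_nat 1 b}" (is "?E = _")
  proof (intro equalityI subsetI)
    fix c assume "c \<in> ?E"
    then have c: "digits c" "val c = val a / q" by (auto simp: is_expansion_iff)
    define t where "t = (\<lambda>k. c (Suc k))"
    have ct: "c = case_nat (c 0) t" by (auto simp: t_def fun_eq_iff split: nat.splits)
    have t: "digits t" using c(1) digits_shift[of c 1] by (simp add: t_def)
    have *: "real (c 0) + val t = val a"
      using val_unfold[OF c(1)] c(2) q_gt_1 by (simp add: t_def)
    from digits_cases[OF c(1), of 0] show "c \<in> {case_nat 0 a, case_nat 1 b}"
    proof
      assume "c 0 = 0"
      then have "t = a" using univoque_unique[OF a t] * by simp
      with ct \<open>c 0 = 0\<close> show ?thesis by simp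
    next
      assume "c 0 = 1"
      then have "t = b" using univoque_unique[OF b t] * diff by simp
      with ct \<open>c 0 = 1\<close> show ?thesis by simp
    qed
  next
    fix c assume "c \<in> {case_nat 0 a, case_nat 1 b}"
    then show "c \<in> ?E"
      using da db diff by (auto simp: is_expansion_iff digits_case_nat val_case_nat)
  qed
  moreover have "case_nat 0 a \<noteq> case_nat 1 b"
    by (metis nat.case(1) zero_neq_one)
  ultimately show "card ?E = 2" by simp
  have "val a / q \<le> L / 1"
    using val_le_L[OF da] q_gt_1 L_gt_1 by (intro frac_le) auto
  then show "val a / q \<in> {0..1 / (q - 1)}"
    using val_nonneg[OF da] q_gt_1 by (simp add: L_def)
qed

text \<open>The two inequalities are what allows \<open>1\<close> to be prefixed to \<open>a\<close>
  and \<open>0\<close> to \<open>b\<close>; prefixing preserves them.\<close>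

definition univoque_diff :: "real \<Rightarrow> bool" where
  "univoque_diff d \<longleftrightarrow> (\<exists>a b. univoque a \<and> univoque b \<and>
     L - val a < 1 \<and> val b < 1 \<and> val a - val b = d)"

lemma univoque_diff_prefix:
  assumes "univoque_diff d"
  shows "univoque_diff ((1 + d) / q)"
proof -
  obtain a b where a: "univoque a" "L - val a < 1" and b: "univoque b" "val b < 1"
    and diff: "val a - val b = d"
    using assms by (auto simp: univoque_diff_def)
  have dig: "digits (case_nat 1 a)" "digits (case_nat 0 b)"
    using a b by (auto simp: digits_case_nat univoque_def)
  have "L - val (case_nat 1 a) = (L - val a) / q"
    using q_mult_L q_gt_1 unfolding val_case_nat[OF dig(1)] by (simp add: field_simps)
  also have "\<dots> < 1" using a(2) q_gt_1 by simp
  finally have "L - val (case_nat 1 a) < 1" .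
  moreover have "val (case_nat 0 b) < 1"
    using b(2) q_gt_1 by (simp add: val_case_nat[OF dig(2)])
  moreover have "univoque (case_nat 1 a)" "univoque (case_nat 0 b)"
    using a b by (auto intro!: univoque_case_nat)
  moreover have "val (case_nat 1 a) - val (case_nat 0 b) = (1 + d) / q"
    using diff unfolding val_case_nat[OF dig(1)] val_case_nat[OF dig(2)]
    by (simp add: diff_divide_distrib[symmetric])
  ultimately show ?thesis unfolding univoque_diff_def by blast
qed

lemma two_expansions_of_univoque_diff:
  "univoque_diff 1 \<Longrightarrow> \<exists>x \<in> {0..1 / (q - 1)}. card {a. is_expansion q x a} = 2"
  unfolding univoque_diff_def using two_expansions by blast

section \<open>Sequences without runs of length 3\<close>

text \<open>The states \<open>-2, -1, 1, 2\<close> record the last run: its length is the absolute value, and it consists of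
  ones if the state is positive. The walks are those that avoid runs of length 3.\<close>

definition step :: "int \<Rightarrow> int \<Rightarrow> bool" where
  "step s s' \<longleftrightarrow> (s, s') \<in> {(-2,1), (-1,1), (-1,-2), (1,-1), (1,2), (2,-1)}"

definition digit :: "int \<Rightarrow> nat" where "digit s = (if 0 < s then 1 else 0)"

text \<open>\<open>A\<close>, \<open>B\<close>, \<open>C\<close> are the values of the sequences \<open>(110)\<close>, \<open>(101)\<close>, \<open>(011)\<close>, repeated
  periodically; these are the largest continuations from the states of \<open>hi\<close>.\<close>

definition A :: real where "A = (q\<^sup>2 + q) / (q ^ 3 - 1)"
definition B :: real where "B = (q\<^sup>2 + 1) / (q ^ 3 - 1)"
definition C :: real where "C = (q + 1) / (q ^ 3 - 1)"

definition hi :: "int \<Rightarrow> real" where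
  "hi s = (if s < 0 then A else if s = 1 then B else C)"

lemma cube_minus_1_pos: "0 < q ^ 3 - 1"
  using q_gt_1 by simp

text \<open>Dropping the first digit turns each of the three periodic sequences into the
  next.\<close>

lemma hi_recursion: "q * A = 1 + B" "q * B = 1 + C" "q * C = A"
  using cube_minus_1_pos
  by (simp_all add: A_def B_def C_def field_simps power2_eq_square power3_eq_cube)

lemma L_eq: "L = (q\<^sup>2 + q + 1) / (q ^ 3 - 1)"
  using q_gt_1 cube_minus_1_pos
  by (simp add: L_def field_simps power2_eq_square power3_eq_cube)

lemma L_le_2B: "L \<le> 2 * B"
proof -
  have "0 \<le> (q - 1)\<^sup>2" by simp
  then have "q\<^sup>2 + q + 1 \<le> 2 * (q\<^sup>2 + 1)"
    using q_gt_1 by (simp add: power2_eq_square algebra_simps)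
  then show ?thesis
    using cube_minus_1_pos unfolding L_eq B_def
    by (simp add: divide_right_mono)
qed

lemma C_le_B: "C \<le> B" and B_le_A: "B \<le> A" and A_le_1_plus_C: "A \<le> 1 + C"
proof -
  have "q * 1 \<le> q * q" using q_gt_1 by (intro mult_left_mono) auto
  then show "C \<le> B" "B \<le> A"
    using cube_minus_1_pos q_gt_1 unfolding A_def B_def C_def
    by (auto intro!: divide_right_mono simp: power2_eq_square)
  then show "A \<le> 1 + C"
    using hi_recursion(2,3) q_gt_1 mult_left_mono[of C B q] by simp
qed

text \<open>The thickness condition, where \<open>q \<le> 2\<close> enters. From the states
  \<open>(-1, -1)\<close>, sums with both first digits 0 reach up to \<open>2 * A\<close>, and those
  with digits 1 and 0 start at \<open>1 + 2 * L - A - C\<close> (both scaled by \<open>q\<close>);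
  the inequality makes these intervals meet.\<close>

lemma overlap: "1 + 2 * L \<le> 3 * A + C"
proof -
  have "0 \<le> q * ((2 - q) * (1 + q))"
    using q_gt_1 q_less_2 by simp
  then have "(q ^ 3 - 1) + 2 * (q\<^sup>2 + q + 1) \<le> 3 * (q\<^sup>2 + q) + (q + 1)"
    by (simp add: power2_eq_square power3_eq_cube algebra_simps)
  then have "((q ^ 3 - 1) + 2 * (q\<^sup>2 + q + 1)) / (q ^ 3 - 1)
      \<le> (3 * (q\<^sup>2 + q) + (q + 1)) / (q ^ 3 - 1)"
    using cube_minus_1_pos by (intro divide_right_mono) auto
  moreover have "((q ^ 3 - 1) + 2 * (q\<^sup>2 + q + 1)) / (q ^ 3 - 1) = 1 + 2 * L"
    using cube_minus_1_pos unfolding L_eq add_divide_distrib[of "q ^ 3 - 1"] by simp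
  moreover have "(3 * (q\<^sup>2 + q) + (q + 1)) / (q ^ 3 - 1) = 3 * A + C"
    unfolding A_def C_def add_divide_distrib[of "3 * (q\<^sup>2 + q)"] by simp
  ultimately show ?thesis by linarith
qed

section \<open>Sums of the values of two walks\<close>

lemma step_uminus: "step s s' \<Longrightarrow> step (- s) (- s')"
  by (auto simp: step_def)

lemma step_ex:
  "(\<exists>s'. step s s' \<and> P s') \<longleftrightarrow>
     (s = -2 \<or> s = -1) \<and> P 1 \<or> s = -1 \<and> P (-2) \<or> (s = 1 \<or> s = 2) \<and> P (-1) \<or> s = 1 \<and> P 2"
  by (auto simp: step_def)

lemma hi_le_A: "hi s \<le> A"
  using C_le_B B_le_A by (auto simp: hi_def)

lemma digit_add_hi_le: "step s s' \<Longrightarrow> real (digit s') + hi s' \<le> q * hi s"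
  using hi_recursion C_le_B B_le_A A_le_1_plus_C by (auto simp: step_def digit_def hi_def)

text \<open>The interval between the extreme sums from states \<open>s\<close> and \<open>t\<close>.
  As complementing digits negates states, the minimum from \<open>s\<close> is
  \<open>L - hi (- s)\<close>.\<close>

definition in_hull :: "int \<Rightarrow> int \<Rightarrow> real \<Rightarrow> bool" where
  "in_hull s t x \<longleftrightarrow> s \<in> {-2, -1, 1, 2} \<and> t \<in> {-2, -1, 1, 2} \<and>
     2 * L - hi (- s) - hi (- t) \<le> x \<and> x \<le> hi s + hi t"

text \<open>The hulls of the successor pairs, scaled back, cover the hull of \<open>(s, t)\<close>:
  the outer end points match by \<open>hi_recursion\<close>, and neighbours meet by
  \<open>overlap\<close>.\<close>

lemma hull_covered:
  assumes "in_hull s t x"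
  shows "\<exists>s'. step s s' \<and> (\<exists>t'. step t t' \<and> in_hull s' t' (q * x - digit s' - digit t'))"
proof -
  have st: "s = -2 \<or> s = -1 \<or> s = 1 \<or> s = 2" "t = -2 \<or> t = -1 \<or> t = 1 \<or> t = 2"
    using assms by (auto simp: in_hull_def)
  have "q * (2 * L - hi (- s) - hi (- t)) \<le> q * x" "q * x \<le> q * (hi s + hi t)"
    using assms q_gt_1 by (auto simp: in_hull_def intro!: mult_left_mono)
  then have x: "2 * (L + 1) - q * hi (- s) - q * hi (- t) \<le> q * x" "q * x \<le> q * hi s + q * hi t"
    using q_mult_L by (auto simp: algebra_simps)
  note le = C_le_B B_le_A overlap
  show ?thesis
    \<comment> \<open>Each of the 16 pairs of states leaves a problem of linear arithmetic.\<close>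
    unfolding step_ex using st(1)
    by (elim disjE; insert st(2); elim disjE; insert x le;
        simp add: in_hull_def digit_def hi_def hi_recursion; argo?)
qed

definition walk :: "(nat \<Rightarrow> int) \<Rightarrow> bool" where
  "walk s \<longleftrightarrow> (\<forall>n. step (s n) (s (Suc n)))"

text \<open>The state \<open>s 0\<close> is only the memory of earlier digits and emits nothing,
  hence \<open>Suc n\<close>.\<close>

definition emit :: "(nat \<Rightarrow> int) \<Rightarrow> nat \<Rightarrow> nat" where
  "emit s n = digit (s (Suc n))"

lemma digits_emit: "digits (emit s)"
  by (auto simp: digits_def emit_def digit_def)

lemma walk_uminus: "walk s \<Longrightarrow> walk (\<lambda>n. - s n)"
  by (simp add: walk_def step_uminus)

lemma walk_shift: "walk s \<Longrightarrow> walk (\<lambda>k. s (n + k))"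
  by (simp add: walk_def)

lemma emit_shift: "(\<lambda>k. emit s (n + k)) = emit (\<lambda>k. s (n + k))"
  by (simp add: emit_def fun_eq_iff)

lemma val_emit_uminus:
  assumes "walk s"
  shows "val (emit (\<lambda>n. - s n)) = L - val (emit s)"
proof (rule val_complement[OF digits_emit])
  fix n
  \<comment> \<open>This excludes the state 0, whose digit negation would not change.\<close>
  have "step (s n) (s (Suc n))" using assms by (simp add: walk_def)
  then show "emit (\<lambda>n. - s n) n = 1 - emit s n"
    by (auto simp: emit_def digit_def step_def)
qed

lemma val_emit_unfold:
  "val (emit (\<lambda>k. s (n + k)))
     = (real (digit (s (Suc n))) + val (emit (\<lambda>k. s (Suc n + k)))) / q"
  using val_unfold[OF digits_emit, of "\<lambda>k. s (n + k)"] unfolding emit_def by simp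

lemma val_emit_le:
  assumes "walk s"
  shows "val (emit s) \<le> hi (s 0)"
proof -
  \<comment> \<open>The excess over the claimed maximum grows at least by the factor
    \<open>q\<close> per digit but is bounded.\<close>
  define f where "f n = val (emit (\<lambda>k. s (n + k))) - hi (s n)" for n
  have "f n \<le> f (Suc n) / q" for n
  proof -
    have "real (digit (s (Suc n))) + hi (s (Suc n)) \<le> q * hi (s n)"
      using assms by (intro digit_add_hi_le) (simp add: walk_def)
    then have "(real (digit (s (Suc n))) + hi (s (Suc n))) / q \<le> hi (s n)"
      using q_gt_1 by (simp add: field_simps)
    then show ?thesis
      unfolding f_def val_emit_unfold[of s n] by (simp add: add_divide_distrib diff_divide_distrib)
  qed
  moreover have "f n \<le> L" for n
  proof -
    have "0 \<le> hi (s n)"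
      using q_gt_1 cube_minus_1_pos by (auto simp: hi_def A_def B_def C_def)
    then show ?thesis
      using val_le_L[OF digits_emit, of "\<lambda>k. s (n + k)"] by (simp add: f_def)
  qed
  ultimately have "f 0 \<le> 0" by (rule nonpos_by_scaling[OF q_gt_1])
  then show ?thesis by (simp add: f_def)
qed

lemma val_emit_bounds:
  assumes "walk s"
  shows "val (emit s) \<le> A" "L - val (emit s) \<le> A"
proof -
  show "val (emit s) \<le> A"
    using val_emit_le[OF assms] hi_le_A order_trans by blast
  show "L - val (emit s) \<le> A"
    using val_emit_le[OF walk_uminus[OF assms]] hi_le_A order_trans
    unfolding val_emit_uminus[OF assms] by blast
qed

text \<open>Every tail is again a walk, with value between \<open>L - A\<close> and
  \<open>A\<close>, so both conditions hold whatever the digit.\<close>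

lemma univoque_emit:
  assumes "walk s" "A < 1"
  shows "univoque (emit s)"
  unfolding univoque_def emit_shift
  using digits_emit val_emit_bounds[OF walk_shift[OF assms(1)]] assms(2)
  by (meson le_less_trans)

text \<open>Following \<open>hull_covered\<close> forever yields two walks and a running target
  \<open>x n\<close> that stays in the hulls.\<close>

lemma hull_realized:
  assumes "in_hull s0 t0 x0"
  obtains s t where "walk s" "walk t" "val (emit s) + val (emit t) = x0"
proof -
  define R where "R = (\<lambda>(n::nat) (s, t, x) (s', t', x').
    step s s' \<and> step t t' \<and> x' = q * x - real (digit s') - real (digit t'))"
  define P where "P = (\<lambda>n::nat. \<lambda>(s, t, x). in_hull s t x \<and> (n = 0 \<longrightarrow> x = x0))"
  have "\<exists>f. \<forall>n. P n (f n) \<and> R n (f n) (f (Suc n))"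
  proof (rule dependent_nat_choice)
    show "\<exists>p. P 0 p" using assms by (auto simp: P_def)
    fix p n assume "P n p"
    then show "\<exists>p'. P (Suc n) p' \<and> R n p p'"
      using hull_covered by (cases p) (fastforce simp: P_def R_def)
  qed
  then obtain f where P: "\<And>n. P n (f n)" and R: "\<And>n. R n (f n) (f (Suc n))" by blast
  define s t x where "s n = fst (f n)" "t n = fst (snd (f n))" "x n = snd (snd (f n))" for n
  have f: "f n = (s n, t n, x n)" for n by (simp add: s_t_x_def)
  have walks: "walk s" "walk t"
    and x: "\<And>n. x (Suc n) = q * x n - real (digit (s (Suc n))) - real (digit (t (Suc n)))"
    using R by (auto simp: R_def f walk_def)
  have hull: "in_hull (s n) (t n) (x n)" and x0: "x 0 = x0" for n
    using P[of n] P[of 0] by (auto simp: P_def f)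
  \<comment> \<open>The error of the tails against the running target is multiplied by
    \<open>q\<close> at each step and bounded, hence 0.\<close>
  define e where "e n = val (emit (\<lambda>k. s (n + k))) + val (emit (\<lambda>k. t (n + k))) - x n" for n
  have e_Suc: "e n = e (Suc n) / q" for n
    unfolding e_def val_emit_unfold[of _ n] x using q_gt_1 by (simp add: field_simps)
  have bound: "\<bar>e n\<bar> \<le> 2 * L + 2 * A" for n
  proof -
    have "2 * L - A - A \<le> x n" "x n \<le> A + A"
      using hull[of n] hi_le_A[of "s n"] hi_le_A[of "t n"] hi_le_A[of "- s n"] hi_le_A[of "- t n"]
      by (auto simp: in_hull_def)
    then show ?thesis
      using val_le_L[OF digits_emit, of "\<lambda>k. s (n + k)"] val_nonneg[OF digits_emit, of "\<lambda>k. s (n + k)"]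
        val_le_L[OF digits_emit, of "\<lambda>k. t (n + k)"] val_nonneg[OF digits_emit, of "\<lambda>k. t (n + k)"] L_gt_1
      by (auto simp: e_def)
  qed
  have "\<bar>e 0\<bar> \<le> 0"
  proof (rule nonpos_by_scaling[OF q_gt_1 _ bound])
    show "\<bar>e n\<bar> \<le> \<bar>e (Suc n)\<bar> / q" for n
      using q_gt_1 by (subst e_Suc) simp
  qed
  then show thesis using that walks x0 by (simp add: e_def)
qed

section \<open>Reaching difference 1\<close>

lemma univoque_diff_hull:
  assumes "A < 1" "0 \<le> d" "d \<le> 2 * A - L"
  shows "univoque_diff d"
proof -
  \<comment> \<open>Complementing the second walk turns the sum \<open>L + d\<close> into the
    difference \<open>d\<close>; from \<open>(-1, -1)\<close> the sums fill
    \<open>2 * L - 2 * B\<close> to \<open>2 * A\<close>.\<close>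
  have "in_hull (-1) (-1) (L + d)"
    using assms L_le_2B by (simp add: in_hull_def hi_def)
  then obtain s t where st: "walk s" "walk t" "val (emit s) + val (emit t) = L + d"
    by (rule hull_realized)
  define r where "r = (\<lambda>n. - t n)"
  have r: "walk r" "val (emit r) = L - val (emit t)"
    using st by (simp_all add: r_def walk_uminus val_emit_uminus)
  show ?thesis
    unfolding univoque_diff_def
    using univoque_emit[OF st(1) assms(1)] univoque_emit[OF r(1) assms(1)]
      val_emit_bounds[OF st(1)] val_emit_bounds[OF r(1)] assms(1) st(3) r(2)
    by (intro exI[of _ "emit s"] exI[of _ "emit r"]) auto
qed

lemma univoque_diff_1:
  assumes "A < 1"
  shows "univoque_diff 1"
proof -
  \<comment> \<open>Closed form of iterating \<open>q * d - 1\<close> from \<open>d 0 = 1\<close>;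
    \<open>L\<close> is the fixed point, and \<open>L > 1\<close> makes the sequence
    decrease.\<close>
  define d where "d n = L - q ^ n * (L - 1)" for n
  have d_Suc: "d (Suc n) = q * d n - 1" for n
    using q_mult_L by (simp add: d_def algebra_simps)
  obtain m where "(2 * L - 2 * A) / (L - 1) < q ^ m"
    using real_arch_pow[OF q_gt_1] by blast
  then have "d m \<le> 2 * A - L"
    using L_gt_1 by (simp add: d_def field_simps)
  define k where "k = (LEAST n. d n \<le> 2 * A - L)"
  have k: "d k \<le> 2 * A - L"
    unfolding k_def using \<open>d m \<le> 2 * A - L\<close> by (rule LeastI)
  have "0 \<le> d k"
  proof (cases k)
    case 0
    then show ?thesis by (simp add: d_def)
  next
    case (Suc j)
    then have "2 * A - L < d j"
      using not_less_Least[of j "\<lambda>n. d n \<le> 2 * A - L"] by (simp add: k_def)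
    \<comment> \<open>No overshoot below 0: \<open>q * (2 * A - L) - 1 = 2 * B - L\<close>, which is
      nonnegative.\<close>
    then have "q * (2 * A - L) < q * d j" using q_gt_1 by simp
    then show ?thesis
      using hi_recursion(1) q_mult_L L_le_2B by (simp add: Suc d_Suc algebra_simps)
  qed
  then have "univoque_diff (d k)"
    using univoque_diff_hull assms k by blast
  moreover have "univoque_diff (d n) \<Longrightarrow> univoque_diff (d 0)" for n
  proof (induction n)
    case (Suc n)
    have "(1 + d (Suc n)) / q = d n" using q_gt_1 by (simp add: d_Suc)
    with univoque_diff_prefix[OF Suc.prems] Suc.IH show ?case by simp
  qed
  ultimately show ?thesis by (auto simp: d_def)
qed

text \<open>For \<open>q = T\<close> we have \<open>A = 1\<close>, so the bound \<open>A\<close> no longer suffices for uniqueness.\<close>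

lemma univoque_diff_1_tribonacci:
  assumes "q ^ 3 = q\<^sup>2 + q + 1"
  shows "univoque_diff 1"
proof -
  \<comment> \<open>The alternating sequences, starting with the parity of \<open>e\<close>: shifts
    and complements only change that parity.\<close>
  define a where "a e n = (n + e) mod 2" for e n :: nat
  have dig: "digits (a e)" for e by (auto simp: digits_def a_def)
  have shift: "(\<lambda>k. a e (n + k)) = a (n + e)" for e n
    by (simp add: a_def fun_eq_iff add_ac)
  have compl: "val (a (Suc e)) = L - val (a e)" for e
    by (rule val_complement[OF dig]) (auto simp: a_def mod_2_eq_odd)
  have "val (a 0) = val (a (Suc 0)) / q" "val (a (Suc 0)) = (1 + val (a 2)) / q"
    using val_unfold[OF dig, of 0] val_unfold[OF dig, of 1] shift[of 0 1] shift[of 1 1]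
    by (simp_all add: a_def numeral_2_eq_2)
  moreover have "a 2 = a 0" by (simp add: a_def fun_eq_iff)
  ultimately have "q * q * val (a 0) = 1 + val (a 0)"
    using q_gt_1 by (simp add: field_simps)
  then have v0: "(q\<^sup>2 - 1) * val (a 0) = 1"
    by (simp add: power2_eq_square algebra_simps)
  have "q * (q + 1) < q * q\<^sup>2"
    using assms by (simp add: power2_eq_square power3_eq_cube algebra_simps)
  then have q: "q + 1 < q\<^sup>2"
    using q_gt_1 by simp
  have "val (a 0) = 1 / (q\<^sup>2 - 1)"
    using v0 q q_gt_1 by (simp add: field_simps)
  then have "val (a 0) < 1" "q * val (a 0) < 1"
    using q q_gt_1 by simp_all
  moreover have "val (a (Suc 0)) = q * val (a 0)"
    using \<open>val (a 0) = val (a (Suc 0)) / q\<close> q_gt_1 by simp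
  moreover have "a e = a (e mod 2)" for e
    by (simp add: a_def fun_eq_iff mod_add_right_eq)
  ultimately have less: "val (a e) < 1" for e
    by (metis One_nat_def mod_2_eq_odd of_bool_eq(1,2))
  have less': "L - val (a e) < 1" for e
    using less[of "Suc e"] compl[of e] by simp
  have "univoque (a 0)"
    unfolding univoque_def shift using dig less less' by blast
  then have "univoque_diff 0"
    unfolding univoque_diff_def using less less' by (intro exI[of _ "a 0"]) auto
  \<comment> \<open>Three prefixings take difference 0 to \<open>1/q + 1/q^2 + 1/q^3\<close>, which
    is 1 by the cubic equation.\<close>
  then have "univoque_diff ((1 + (1 + (1 + 0) / q) / q) / q)"
    by (intro univoque_diff_prefix)
  moreover have "(1 + (1 + (1 + 0) / q) / q) / q = (q\<^sup>2 + q + 1) / q ^ 3"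
    using q_gt_1 by (simp add: field_simps power2_eq_square power3_eq_cube)
  moreover have "\<dots> = 1"
    using q_gt_1 by (simp add: assms[symmetric])
  ultimately show ?thesis by simp
qed

end

section \<open>The cubic polynomial at and beyond its root\<close>

lemma tribonacci_gt_1: "1 < tribonacci"
proof (rule ccontr)
  let ?T = tribonacci
  assume "\<not> 1 < ?T"
  have eq: "?T\<^sup>2 * (?T - 1) = ?T + 1"
    using tribonacci_root by (simp add: algebra_simps power2_eq_square power3_eq_cube)
  have "?T\<^sup>2 * (?T - 1) \<le> 0"
    using \<open>\<not> 1 < ?T\<close> by (simp add: mult_nonneg_nonpos)
  then have "?T \<le> -1" using eq by simp
  then have "?T ^ 3 < 0" by simp
  moreover have "0 \<le> (2 * ?T + 1)\<^sup>2" by simp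
  then have "0 < ?T\<^sup>2 + ?T + 1" by (simp add: power2_eq_square algebra_simps)
  ultimately show False using tribonacci_root by simp
qed

lemma tribonacci_less_imp:
  assumes "tribonacci < q"
  shows "q\<^sup>2 + q + 1 < q ^ 3"
proof -
  let ?T = tribonacci
  have T: "1 < ?T" by (rule tribonacci_gt_1)
  \<comment> \<open>This is the cofactor of \<open>q - ?T\<close> in the difference of the values of
    \<open>x^3 - x^2 - x - 1\<close> at \<open>q\<close> and \<open>?T\<close>, grouped into
    positive terms.\<close>
  have "0 < q * (q - 1) + ?T * (?T - 1) + (q * ?T - 1)"
    using T assms by (intro add_pos_pos) (auto simp: less_1_mult)
  then have "0 < (q - ?T) * (q * (q - 1) + ?T * (?T - 1) + (q * ?T - 1))"
    using assms by simp
  also have "\<dots> = (q ^ 3 - q\<^sup>2 - q - 1) - (?T ^ 3 - ?T\<^sup>2 - ?T - 1)"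
    by (simp add: power2_eq_square power3_eq_cube algebra_simps)
  finally show ?thesis using tribonacci_root by simp
qed

theorem theorem4p2:
  fixes q :: real
  assumes "q \<in> {tribonacci..<2}"
  shows "\<exists>x \<in> {0..1 / (q - 1)}. card {a. is_expansion q x a} = 2"
proof -
  interpret expansion_base q
    using assms tribonacci_gt_1 by unfold_locales auto
  have "univoque_diff 1"
  proof (cases "q = tribonacci")
    case True
    then show ?thesis using univoque_diff_1_tribonacci tribonacci_root by simp
  next
    case False
    then have "q\<^sup>2 + q + 1 < q ^ 3" using assms by (intro tribonacci_less_imp) auto
    then have "A < 1" using cube_minus_1_pos by (simp add: A_def)
    then show ?thesis by (rule univoque_diff_1)
  qed
  then show ?thesis by (rule two_expansions_of_univoque_diff)
qed

end
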